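(* The classical K-net Lax representation $$L=\begin{pmatrix}x&\mathrm{i}\lambda\\\mathrm{i}\lambda&\bar x\end{pmatrix},\qquad M=\begin{pmatrix}1&\frac y\lambda\\\frac{-\bar y}\lambda&1\end{pmatrix},\qquad\lambda=e^t,$$ with complex functions $x$, $y$ on the edges of the first and second direction of $\mathbb{Z}^2$ and compatibility condition $L_2M=M_1L$, is gauge equivalent to the Lax representation $$U=\begin{pmatrix}\lambda&\frac1\lambda a\\-\frac1\lambda\bar a&\lambda\end{pmatrix},\qquad V=\begin{pmatrix}\lambda&\frac1\lambda b\\-\frac1\lambda\bar b&\lambda\end{pmatrix},\qquad\lambda=e^t,$$ with complex functions $a$, $b$ on the edges of the first and second direction of $\mathbb{Z}^2$ and compatibility condition $U_2V=V_1U$.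
   Context: Subscripts denote shifts in the lattice directions of $\mathbb{Z}^2$. The compatibility condition is that of the frame equations $\Phi_1=L\Phi$, $\Phi_2=M\Phi$ (respectively $\Phi_1=U\Phi$, $\Phi_2=V\Phi$). A gauge is a transformation $\Phi\mapsto G\Phi$ with a vertex based invertible matrix $G$ not depending on $\lambda$, so $L\mapsto G_1LG^{-1}$, $M\mapsto G_2MG^{-1}$. Two Lax representations are gauge equivalent if every solution pair of either one can be transformed into a solution pair of the other by a gauge, together with a reparametrization of the spectral parameter (here replacing $\lambda$ by $\lambda^2$) and multiplication of the matrices by nonzero scalars (possibly depending on $\lambda$) that do not affect the compatibility condition. *)

theory Defs
  imports "HOL-Analysis.Analysis"
begin

type_synonym vertex = "int \<times> int"
type_synonym mat2 = "complex ^ 2 ^ 2"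

definition shift1 :: "vertex \<Rightarrow> vertex" where
  "shift1 p = (fst p + 1, snd p)"

definition shift2 :: "vertex \<Rightarrow> vertex" where
  "shift2 p = (fst p, snd p + 1)"

text \<open>
  A function on the edges of the first (second) lattice direction is encoded as a function
  on vertices: its value at \<open>p\<close> belongs to the edge from \<open>p\<close> to \<open>shift1 p\<close> (to \<open>shift2 p\<close>).
\<close>

type_synonym edge_fun = "vertex \<Rightarrow> complex"

text \<open>A matrix on each edge of one direction, depending on the spectral parameter.\<close>

type_synonym lax_family = "real \<Rightarrow> vertex \<Rightarrow> mat2"

text \<open>The values \<open>\<mu> = e\<^sup>t\<close>, \<open>t\<close> real, of the spectral parameter, usually called lambda.\<close>

definition spectral :: "real set" where
  "spectral = range exp"

text \<open>Compatibility of \<open>\<Phi>\<^sub>1 = L \<Phi>\<close>, \<open>\<Phi>\<^sub>2 = M \<Phi>\<close>, i.e. \<open>L\<^sub>2 M = M\<^sub>1 L\<close>, identically in \<open>\<mu>\<close>.\<close>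

definition compatible :: "lax_family \<Rightarrow> lax_family \<Rightarrow> bool" where
  "compatible L M \<longleftrightarrow>
     (\<forall>\<mu>\<in>spectral. \<forall>p. L \<mu> (shift2 p) ** M \<mu> p = M \<mu> (shift1 p) ** L \<mu> p)"

definition cscale :: "complex \<Rightarrow> mat2 \<Rightarrow> mat2" where
  "cscale c A = (\<chi> i j. c * A $ i $ j)"

text \<open>
  Nonzero scalar factors, depending on \<open>\<mu>\<close> and possibly on the edge, that do not affect the
  compatibility condition, whatever the matrices are that they multiply.
\<close>

definition admissible_scalars ::
    "(real \<Rightarrow> vertex \<Rightarrow> complex) \<Rightarrow> (real \<Rightarrow> vertex \<Rightarrow> complex) \<Rightarrow> bool" where
  "admissible_scalars \<alpha> \<beta> \<longleftrightarrow>
     (\<forall>\<mu>\<in>spectral. \<forall>p. \<alpha> \<mu> p \<noteq> 0 \<and> \<beta> \<mu> p \<noteq> 0) \<and>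
     (\<forall>L M. compatible (\<lambda>\<mu> p. cscale (\<alpha> \<mu> p) (L \<mu> p)) (\<lambda>\<mu> p. cscale (\<beta> \<mu> p) (M \<mu> p))
            \<longleftrightarrow> compatible L M)"

text \<open>
  \<open>(L', M')\<close> arises from \<open>(L, M)\<close> by a gauge \<open>\<Phi> \<mapsto> G \<Phi>\<close>, with \<open>G\<close> living on vertices and
  independent of \<open>\<mu>\<close>, and multiplication by admissible scalars.
\<close>

definition gauge_transformed ::
    "lax_family \<Rightarrow> lax_family \<Rightarrow> lax_family \<Rightarrow> lax_family \<Rightarrow> bool" where
  "gauge_transformed L M L' M' \<longleftrightarrow>
     (\<exists>(G :: vertex \<Rightarrow> mat2) \<alpha> \<beta>.
        (\<forall>p. invertible (G p)) \<and> admissible_scalars \<alpha> \<beta> \<and>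
        (\<forall>\<mu>\<in>spectral. \<forall>p.
           L' \<mu> p = cscale (\<alpha> \<mu> p) (G (shift1 p) ** L \<mu> p ** matrix_inv (G p)) \<and>
           M' \<mu> p = cscale (\<beta> \<mu> p) (G (shift2 p) ** M \<mu> p ** matrix_inv (G p))))"

text \<open>
  A Lax representation is given by two maps, assigning to edge functions of the first
  and second direction the respective matrices; its solution pairs are the pairs of edge
  functions for which the matrices are compatible.  The bijection \<open>\<rho>\<close> is the reparametrization
  of the spectral parameter: the matrices \<open>L\<close>, \<open>M\<close> taken at \<open>\<rho> \<mu>\<close> correspond to \<open>U\<close>, \<open>V\<close> taken
  at \<open>\<mu>\<close>, in both directions of the equivalence.
\<close>

definition gauge_equivalent ::
    "(real \<Rightarrow> real) \<Rightarrow> (edge_fun \<Rightarrow> lax_family) \<times> (edge_fun \<Rightarrow> lax_family)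
       \<Rightarrow> (edge_fun \<Rightarrow> lax_family) \<times> (edge_fun \<Rightarrow> lax_family) \<Rightarrow> bool" where
  "gauge_equivalent \<rho> = (\<lambda>(L, M) (U, V).
     bij_betw \<rho> spectral spectral \<and>
     (\<forall>x y. compatible (L x) (M y) \<longrightarrow>
        (\<exists>a b. compatible (U a) (V b) \<and>
           gauge_transformed (\<lambda>\<mu>. L x (\<rho> \<mu>)) (\<lambda>\<mu>. M y (\<rho> \<mu>)) (U a) (V b))) \<and>
     (\<forall>a b. compatible (U a) (V b) \<longrightarrow>
        (\<exists>x y. compatible (L x) (M y) \<and>
           gauge_transformed (U a) (V b) (\<lambda>\<mu>. L x (\<rho> \<mu>)) (\<lambda>\<mu>. M y (\<rho> \<mu>)))))"

definition Knet_L :: "edge_fun \<Rightarrow> lax_family" where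
  "Knet_L x \<mu> p = vector [vector [x p, \<i> * of_real \<mu>],
                          vector [\<i> * of_real \<mu>, cnj (x p)]]"

definition Knet_M :: "edge_fun \<Rightarrow> lax_family" where
  "Knet_M y \<mu> p = vector [vector [1, y p / of_real \<mu>],
                          vector [- cnj (y p) / of_real \<mu>, 1]]"

definition Lax_U :: "edge_fun \<Rightarrow> lax_family" where
  "Lax_U a \<mu> p = vector [vector [of_real \<mu>, 1 / of_real \<mu> * a p],
                         vector [- (1 / of_real \<mu>) * cnj (a p), of_real \<mu>]]"

definition Lax_V :: "edge_fun \<Rightarrow> lax_family" where
  "Lax_V b \<mu> p = vector [vector [of_real \<mu>, 1 / of_real \<mu> * b p],
                         vector [- (1 / of_real \<mu>) * cnj (b p), of_real \<mu>]]"

end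

theory Submission
  imports Defs
begin

text \<open>
  Put \<open>S = [[0, 1], [1, 0]]\<close>. Multiplying the K-net matrix \<open>L\<close> by \<open>S\<close> from either side moves the
  entries \<open>\<i> \<lambda>\<close> to the diagonal, while conjugating \<open>M\<close> by \<open>S\<close> replaces \<open>y\<close> by \<open>- cnj y\<close>. Hence
  the gauge \<open>G\<close> that equals \<open>1\<close> at vertices with even and \<open>S\<close> at vertices with odd first coordinate
  turns \<open>L\<close>, \<open>M\<close>, taken at \<open>\<lambda>\<^sup>2\<close>, into \<open>U\<close>, \<open>V\<close>, up to the factors \<open>\<i> \<lambda>\<close> and \<open>1 / \<lambda>\<close>.
\<close>

section \<open>Scalar multiples of matrices and the form of the compatibility condition\<close>

lemma cscale_component [simp]: "cscale c A $ i $ j = c * A $ i $ j"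
  by (simp add: cscale_def)

lemma cscale_cscale [simp]: "cscale c (cscale d A) = cscale (c * d) A"
  by (simp add: vec_eq_iff mult.assoc)

lemma cscale_one [simp]: "cscale 1 A = A"
  by (simp add: vec_eq_iff)

lemma cscale_mult_left: "cscale c A ** B = cscale c (A ** B)"
  by (simp add: vec_eq_iff matrix_matrix_mult_def sum_distrib_left mult.assoc)

lemma cscale_mult_right: "A ** cscale c B = cscale c (A ** B)"
  by (simp add: vec_eq_iff matrix_matrix_mult_def sum_distrib_left mult.left_commute)

lemma cscale_inject: "c \<noteq> 0 \<Longrightarrow> cscale c A = cscale c B \<longleftrightarrow> A = B"
  by (simp add: vec_eq_iff)

lemma compatible_cong:
  assumes "\<And>\<mu> p. \<mu> \<in> spectral \<Longrightarrow> L \<mu> p = L' \<mu> p"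
    and "\<And>\<mu> p. \<mu> \<in> spectral \<Longrightarrow> M \<mu> p = M' \<mu> p"
  shows "compatible L M \<longleftrightarrow> compatible L' M'"
  using assms by (simp add: compatible_def)

text \<open>Compatibility quantifies over all of \<open>spectral\<close>, so a map onto
  \<open>spectral\<close> merely relabels the parameter values.\<close>

lemma compatible_reparam:
  assumes "\<rho> ` spectral = spectral"
  shows "compatible (\<lambda>\<mu>. L (\<rho> \<mu>)) (\<lambda>\<mu>. M (\<rho> \<mu>)) \<longleftrightarrow> compatible L M"
proof -
  have "compatible L M \<longleftrightarrow>
      (\<forall>\<mu>\<in>\<rho> ` spectral. \<forall>p. L \<mu> (shift2 p) ** M \<mu> p = M \<mu> (shift1 p) ** L \<mu> p)"
    by (simp only: assms compatible_def)
  then show ?thesis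
    by (simp add: compatible_def)
qed

lemma shift_commute: "shift1 (shift2 p) = shift2 (shift1 p)"
  by (simp add: shift1_def shift2_def)

section \<open>Inverses and cancellation of gauge factors\<close>

lemma
  fixes A :: "'a::semiring_1 ^ 'n ^ 'm"
  assumes "invertible A"
  shows matrix_inv_right: "A ** matrix_inv A = mat 1"
    and matrix_inv_left: "matrix_inv A ** A = mat 1"
  using someI_ex[OF assms[unfolded invertible_def]] by (simp_all add: matrix_inv_def)

lemma matrix_inv_eqI:
  fixes A B :: mat2
  assumes "A ** B = mat 1" "B ** A = mat 1"
  shows "matrix_inv A = B"
proof -
  have "invertible A"
    using assms by (auto simp: invertible_def)
  then have "matrix_inv A = matrix_inv A ** (A ** B)"
    using assms by simp
  also have "\<dots> = B"
    using \<open>invertible A\<close> by (simp add: matrix_mul_assoc matrix_inv_left)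
  finally show ?thesis .
qed

lemma gauge_mult_cancel:
  fixes A B G H K :: mat2
  assumes "invertible H"
  shows "(G ** A ** matrix_inv H) ** (H ** B ** K) = G ** (A ** B) ** K"
proof -
  have "(G ** A ** matrix_inv H) ** (H ** B ** K) = G ** A ** (matrix_inv H ** H) ** B ** K"
    by (simp only: matrix_mul_assoc)
  also have "\<dots> = G ** (A ** B) ** K"
    using assms by (simp add: matrix_inv_left matrix_mul_assoc)
  finally show ?thesis .
qed

lemma gauge_inverse:
  fixes A G H :: mat2
  assumes "invertible G" "invertible H"
  shows "matrix_inv G ** (G ** A ** matrix_inv H) ** H = A"
proof -
  have "matrix_inv G ** (G ** A ** matrix_inv H) ** H
      = (matrix_inv G ** G) ** A ** (matrix_inv H ** H)"
    by (simp only: matrix_mul_assoc)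
  then show ?thesis
    using assms by (simp add: matrix_inv_left)
qed

text \<open>Both sides of the condition lead from \<open>p\<close> to the opposite vertex of its
  square. The factors at the intermediate vertex cancel, and since the shifts commute, both sides
  keep the same outer factors.\<close>

lemma compatible_gauge:
  fixes G :: "vertex \<Rightarrow> mat2"
  assumes inv: "\<And>p. invertible (G p)"
  shows "compatible (\<lambda>\<mu> p. G (shift1 p) ** L \<mu> p ** matrix_inv (G p))
                    (\<lambda>\<mu> p. G (shift2 p) ** M \<mu> p ** matrix_inv (G p)) \<longleftrightarrow> compatible L M"
proof -
  \<comment> \<open>By \<open>gauge_inverse\<close> the inner matrix can be recovered from the
    product, so the common outer factors may be dropped.\<close>
  have inject: "H ** A ** matrix_inv K = H ** B ** matrix_inv K \<longleftrightarrow> A = B"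
    if "invertible H" "invertible K" for A B H K :: mat2
    using gauge_inverse[OF that] by metis
  show ?thesis
    by (simp add: compatible_def gauge_mult_cancel inject inv shift_commute)
qed

lemma admissible_scalars_nonzero:
  assumes "admissible_scalars \<alpha> \<beta>" and "\<mu> \<in> spectral"
  shows "\<alpha> \<mu> p \<noteq> 0" and "\<beta> \<mu> p \<noteq> 0"
proof -
  have "\<forall>p. \<alpha> \<mu> p \<noteq> 0 \<and> \<beta> \<mu> p \<noteq> 0"
    by (rule bspec[OF conjunct1[OF assms(1)[unfolded admissible_scalars_def]] assms(2)])
  then show "\<alpha> \<mu> p \<noteq> 0" and "\<beta> \<mu> p \<noteq> 0"
    by blast+
qed

lemma admissible_scalars_compatible:
  assumes "admissible_scalars \<alpha> \<beta>"
  shows "compatible (\<lambda>\<mu> p. cscale (\<alpha> \<mu> p) (L \<mu> p)) (\<lambda>\<mu> p. cscale (\<beta> \<mu> p) (M \<mu> p)) \<longleftrightarrow>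
    compatible L M"
  by (rule conjunct2[OF assms[unfolded admissible_scalars_def], rule_format])

lemma gauge_transformed_compatible:
  assumes "gauge_transformed L M L' M'"
  shows "compatible L' M' \<longleftrightarrow> compatible L M"
proof -
  obtain G :: "vertex \<Rightarrow> mat2" and \<alpha> \<beta> where inv: "\<And>p. invertible (G p)"
    and adm: "admissible_scalars \<alpha> \<beta>"
    and L': "\<And>\<mu> p. \<mu> \<in> spectral \<Longrightarrow>
      L' \<mu> p = cscale (\<alpha> \<mu> p) (G (shift1 p) ** L \<mu> p ** matrix_inv (G p))"
    and M': "\<And>\<mu> p. \<mu> \<in> spectral \<Longrightarrow>
      M' \<mu> p = cscale (\<beta> \<mu> p) (G (shift2 p) ** M \<mu> p ** matrix_inv (G p))"
    using assms unfolding gauge_transformed_def by blast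
  have "compatible L' M' \<longleftrightarrow>
      compatible (\<lambda>\<mu> p. cscale (\<alpha> \<mu> p) (G (shift1 p) ** L \<mu> p ** matrix_inv (G p)))
                 (\<lambda>\<mu> p. cscale (\<beta> \<mu> p) (G (shift2 p) ** M \<mu> p ** matrix_inv (G p)))"
    by (rule compatible_cong) (simp_all add: L' M')
  also have "\<dots> \<longleftrightarrow> compatible (\<lambda>\<mu> p. G (shift1 p) ** L \<mu> p ** matrix_inv (G p))
                               (\<lambda>\<mu> p. G (shift2 p) ** M \<mu> p ** matrix_inv (G p))"
    by (rule admissible_scalars_compatible[OF adm])
  also have "\<dots> \<longleftrightarrow> compatible L M"
    by (rule compatible_gauge) (rule inv)
  finally show ?thesis .
qed

text \<open>Admissibility speaks about arbitrary families, in particular about those already divided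
  by \<alpha> and \<beta>. Multiplying these back restores the original families on
  \<open>spectral\<close>.\<close>

lemma admissible_scalars_inverse:
  assumes "admissible_scalars \<alpha> \<beta>"
  shows "admissible_scalars (\<lambda>\<mu> p. inverse (\<alpha> \<mu> p)) (\<lambda>\<mu> p. inverse (\<beta> \<mu> p))"
proof -
  have nz: "\<alpha> \<mu> p \<noteq> 0" "\<beta> \<mu> p \<noteq> 0" if "\<mu> \<in> spectral" for \<mu> p
    by (rule admissible_scalars_nonzero[OF assms that])+
  have "compatible (\<lambda>\<mu> p. cscale (inverse (\<alpha> \<mu> p)) (L \<mu> p))
                   (\<lambda>\<mu> p. cscale (inverse (\<beta> \<mu> p)) (M \<mu> p)) \<longleftrightarrow> compatible L M" for L M
  proof -
    have "compatible (\<lambda>\<mu> p. cscale (inverse (\<alpha> \<mu> p)) (L \<mu> p))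
                     (\<lambda>\<mu> p. cscale (inverse (\<beta> \<mu> p)) (M \<mu> p)) \<longleftrightarrow>
        compatible (\<lambda>\<mu> p. cscale (\<alpha> \<mu> p) (cscale (inverse (\<alpha> \<mu> p)) (L \<mu> p)))
                   (\<lambda>\<mu> p. cscale (\<beta> \<mu> p) (cscale (inverse (\<beta> \<mu> p)) (M \<mu> p)))"
      by (rule admissible_scalars_compatible[OF assms, symmetric])
    also have "\<dots> \<longleftrightarrow> compatible L M"
      by (rule compatible_cong) (simp_all add: nz)
    finally show ?thesis .
  qed
  then show ?thesis
    using nz by (simp add: admissible_scalars_def)
qed

text \<open>Each side of the condition contains one matrix of either direction, so both acquire the
  same nonzero factor \<alpha> \<beta>.\<close>

lemma admissible_scalars_vertex_independent:
  assumes "\<And>\<mu>. \<mu> \<in> spectral \<Longrightarrow> \<alpha> \<mu> \<noteq> 0 \<and> \<beta> \<mu> \<noteq> 0"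
  shows "admissible_scalars (\<lambda>\<mu> p. \<alpha> \<mu>) (\<lambda>\<mu> p. \<beta> \<mu>)"
  using assms
  by (simp add: admissible_scalars_def compatible_def cscale_mult_left cscale_mult_right
      cscale_inject mult.commute)

lemma gauge_transformedI:
  assumes "\<And>p. invertible (G p)" and "admissible_scalars \<alpha> \<beta>"
    and "\<And>\<mu> p. \<mu> \<in> spectral \<Longrightarrow>
      L' \<mu> p = cscale (\<alpha> \<mu> p) (G (shift1 p) ** L \<mu> p ** matrix_inv (G p))"
    and "\<And>\<mu> p. \<mu> \<in> spectral \<Longrightarrow>
      M' \<mu> p = cscale (\<beta> \<mu> p) (G (shift2 p) ** M \<mu> p ** matrix_inv (G p))"
  shows "gauge_transformed L M L' M'"
  unfolding gauge_transformed_def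
  by (rule exI[of _ G], rule exI[of _ \<alpha>], rule exI[of _ \<beta>])
    (intro conjI ballI allI assms)

text \<open>The inverse gauge with the reciprocal scalars undoes the transformation. This yields the
  backward half of the equivalence from the forward computation.\<close>

lemma gauge_transformed_sym:
  assumes "gauge_transformed L M L' M'"
  shows "gauge_transformed L' M' L M"
proof -
  obtain G :: "vertex \<Rightarrow> mat2" and \<alpha> \<beta> where inv: "\<And>p. invertible (G p)"
    and adm: "admissible_scalars \<alpha> \<beta>"
    and L': "\<And>\<mu> p. \<mu> \<in> spectral \<Longrightarrow>
      L' \<mu> p = cscale (\<alpha> \<mu> p) (G (shift1 p) ** L \<mu> p ** matrix_inv (G p))"
    and M': "\<And>\<mu> p. \<mu> \<in> spectral \<Longrightarrow>
      M' \<mu> p = cscale (\<beta> \<mu> p) (G (shift2 p) ** M \<mu> p ** matrix_inv (G p))"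
    using assms unfolding gauge_transformed_def by blast
  let ?H = "\<lambda>p. matrix_inv (G p)"
  have nz: "\<alpha> \<mu> p \<noteq> 0" "\<beta> \<mu> p \<noteq> 0" if "\<mu> \<in> spectral" for \<mu> p
    by (rule admissible_scalars_nonzero[OF adm that])+
  have inv_H: "matrix_inv (?H p) = G p" for p
    using inv by (intro matrix_inv_eqI) (simp_all add: matrix_inv_left matrix_inv_right)
  show ?thesis
  proof (rule gauge_transformedI[where G = ?H and \<alpha> = "\<lambda>\<mu> p. inverse (\<alpha> \<mu> p)"
        and \<beta> = "\<lambda>\<mu> p. inverse (\<beta> \<mu> p)"])
    show "invertible (?H p)" for p
      using inv[of p] matrix_inv_left matrix_inv_right unfolding invertible_def by blast
    show "admissible_scalars (\<lambda>\<mu> p. inverse (\<alpha> \<mu> p)) (\<lambda>\<mu> p. inverse (\<beta> \<mu> p))"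
      using adm by (rule admissible_scalars_inverse)
  qed (simp_all add: L' M' inv_H nz cscale_mult_left cscale_mult_right gauge_inverse inv)
qed

section \<open>The explicit gauge and the change of edge functions\<close>

definition swap_mat :: mat2 where
  "swap_mat = vector [vector [0, 1], vector [1, 0]]"

text \<open>A step in the first direction flips the parity, so exactly one of the two factors around
  \<open>L\<close> is \<open>swap_mat\<close>. A step in the second direction keeps it, so
  \<open>M\<close> is conjugated.\<close>

definition parity_gauge :: "vertex \<Rightarrow> mat2" where
  "parity_gauge p = (if even (fst p) then mat 1 else swap_mat)"

text \<open>At even vertices the rows of \<open>L\<close> are swapped, which brings
  \<open>cnj (x p)\<close> to the upper right; at odd ones the columns are, which brings
  \<open>x p\<close> there. The factor \<open>- \<i>\<close> comes from dividing by
  \<open>\<i>\<close> times the parameter.\<close>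

definition Knet_to_a :: "edge_fun \<Rightarrow> edge_fun" where
  "Knet_to_a x p = - \<i> * (if even (fst p) then cnj (x p) else x p)"

definition Knet_to_b :: "edge_fun \<Rightarrow> edge_fun" where
  "Knet_to_b y p = (if even (fst p) then y p else - cnj (y p))"

lemma swap_mat_involution: "swap_mat ** swap_mat = mat 1"
  by (simp add: swap_mat_def vec_eq_iff forall_2 matrix_matrix_mult_def sum_2 mat_def)

lemma parity_gauge_involution: "parity_gauge p ** parity_gauge p = mat 1"
  by (simp add: parity_gauge_def swap_mat_involution)

lemma invertible_parity_gauge: "invertible (parity_gauge p)"
  using parity_gauge_involution unfolding invertible_def by blast

lemma matrix_inv_parity_gauge: "matrix_inv (parity_gauge p) = parity_gauge p"
  by (intro matrix_inv_eqI parity_gauge_involution)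

text \<open>The gauged matrix has diagonal \<open>\<i> * \<mu>\<^sup>2\<close> and off-diagonal
  entries free of \<mu>; division by \<open>\<i> * \<mu>\<close> gives \<mu> and multiples of 1 /
  \<mu>. This is where the square in the reparametrization comes from.\<close>

lemma Lax_U_gauge:
  assumes "\<mu> \<noteq> 0"
  shows "Lax_U (Knet_to_a x) \<mu> p = cscale (- \<i> / of_real \<mu>)
    (parity_gauge (shift1 p) ** Knet_L x (\<mu>\<^sup>2) p ** parity_gauge p)"
  using assms
  by (simp add: Lax_U_def Knet_L_def Knet_to_a_def parity_gauge_def swap_mat_def shift1_def
      vec_eq_iff forall_2 matrix_matrix_mult_def sum_2 mat_def power2_eq_square field_simps)

lemma Lax_V_gauge:
  assumes "\<mu> \<noteq> 0"
  shows "Lax_V (Knet_to_b y) \<mu> p = cscale (of_real \<mu>)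
    (parity_gauge (shift2 p) ** Knet_M y (\<mu>\<^sup>2) p ** parity_gauge p)"
  using assms
  by (simp add: Lax_V_def Knet_M_def Knet_to_b_def parity_gauge_def swap_mat_def shift2_def
      vec_eq_iff forall_2 matrix_matrix_mult_def sum_2 mat_def power2_eq_square field_simps)

lemma spectral_eq: "spectral = {0<..}"
  by (auto simp: spectral_def image_iff) (metis exp_ln)

lemma Knet_gauge_transformed:
  "gauge_transformed (\<lambda>\<mu>. Knet_L x (\<mu>\<^sup>2)) (\<lambda>\<mu>. Knet_M y (\<mu>\<^sup>2))
     (Lax_U (Knet_to_a x)) (Lax_V (Knet_to_b y))"
proof (rule gauge_transformedI[where G = parity_gauge
      and \<alpha> = "\<lambda>\<mu> p. - \<i> / of_real \<mu>" and \<beta> = "\<lambda>\<mu> p. of_real \<mu>"])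
  show "admissible_scalars (\<lambda>\<mu> p. - \<i> / of_real \<mu>) (\<lambda>\<mu> p. of_real \<mu>)"
    by (rule admissible_scalars_vertex_independent) (simp add: spectral_eq)
qed (simp_all add: invertible_parity_gauge matrix_inv_parity_gauge Lax_U_gauge Lax_V_gauge
    spectral_eq)

lemma Knet_to_a_surj: "\<exists>x. Knet_to_a x = a"
  \<comment> \<open>The witness solves \<open>- \<i> * cnj (x p) = a p\<close> at even and
    \<open>- \<i> * x p = a p\<close> at odd vertices.\<close>
  by (rule exI[of _ "\<lambda>p. if even (fst p) then - \<i> * cnj (a p) else \<i> * a p"])
    (auto simp: Knet_to_a_def fun_eq_iff)

lemma Knet_to_b_surj: "\<exists>y. Knet_to_b y = b"
  \<comment> \<open>\<open>Knet_to_b\<close> is an involution.\<close>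
  by (rule exI[of _ "Knet_to_b b"]) (auto simp: Knet_to_b_def fun_eq_iff)

lemma bij_betw_square_spectral: "bij_betw (\<lambda>\<mu>. \<mu>\<^sup>2) spectral spectral"
  unfolding spectral_eq
  by (rule bij_betwI[where g = sqrt]) auto

theorem proposition4p4:
  shows "gauge_equivalent (\<lambda>\<mu>. \<mu>\<^sup>2) (Knet_L, Knet_M) (Lax_U, Lax_V)"
proof -
  \<comment> \<open>Gauge invariance reduces the left side to the K-net matrices at
    \<open>\<mu>\<^sup>2\<close>, and surjectivity of squaring on \<open>spectral\<close> removes
    the square.\<close>
  have compat: "compatible (Lax_U (Knet_to_a x)) (Lax_V (Knet_to_b y)) \<longleftrightarrow>
      compatible (Knet_L x) (Knet_M y)" for x y
    using gauge_transformed_compatible[OF Knet_gauge_transformed]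
      compatible_reparam[OF bij_betw_imp_surj_on[OF bij_betw_square_spectral]]
    by simp
  have forward: "\<exists>a b. compatible (Lax_U a) (Lax_V b) \<and>
      gauge_transformed (\<lambda>\<mu>. Knet_L x (\<mu>\<^sup>2)) (\<lambda>\<mu>. Knet_M y (\<mu>\<^sup>2)) (Lax_U a) (Lax_V b)"
    if "compatible (Knet_L x) (Knet_M y)" for x y
    using that compat Knet_gauge_transformed by blast
  have backward: "\<exists>x y. compatible (Knet_L x) (Knet_M y) \<and>
      gauge_transformed (Lax_U a) (Lax_V b) (\<lambda>\<mu>. Knet_L x (\<mu>\<^sup>2)) (\<lambda>\<mu>. Knet_M y (\<mu>\<^sup>2))"
    if "compatible (Lax_U a) (Lax_V b)" for a b
  proof -
    \<comment> \<open>Every pair \<open>a\<close>, \<open>b\<close> is the image of some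
      \<open>x\<close>, \<open>y\<close>, so the forward transformation can be inverted for
      it.\<close>
    obtain x y where "Knet_to_a x = a" "Knet_to_b y = b"
      using Knet_to_a_surj Knet_to_b_surj by blast
    then show ?thesis
      using that compat gauge_transformed_sym[OF Knet_gauge_transformed] by blast
  qed
  show ?thesis
    unfolding gauge_equivalent_def
    using bij_betw_square_spectral forward backward by simp
qed

end
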